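(* Assume the point cloud consists of $N$ points in $\Omega\subset\mathbb{R}^d$, with $E=\mathcal{O}(N)$ edges in the connectivity. Then the inference cost of the point cloud neural layer from $f_{\rm in}:\Omega\to\mathbb{R}^{d_{\rm in}}$ to $f_{\rm out}:\Omega\to\mathbb{R}^{d_{\rm out}}$ on the point cloud, with a truncated number $k_{\max}$ of Fourier modes, is $$\mathcal{O}\Bigl(N\,d_{\rm in}\,d_{\rm out}\,(k_{\max}+d)+E\,d_{\rm in}\,d\Bigr).$$
   Context: Point cloud neural layer. The layer maps $f_{\rm in}:\Omega\to\mathbb{R}^{d_{\rm in}}$ to $f_{\rm out}:\Omega\to\mathbb{R}^{d_{\rm out}}$ by $$f_{\rm out}(x)=\sigma\Bigl(W^l f_{\rm in}(x)+b+\sum_{k}\int_\Omega e^{2\pi \mathrm{i}\frac{k}{L}\cdot(x-y)}\,W^v_k f_{\rm in}(y)\,\rho(y;\Omega)\,dy+W^g\,\widetilde\nabla f_{\rm in}(x)\Bigr),$$ where the sum runs over a truncated set of $k_{\max}$ frequencies $k\in\mathbb{Z}^d$; $L\in\mathbb{R}_+^d$ is a vector of length scales and $k/L$ is the componentwise quotient; $W^l\in\mathbb{R}^{d_{\rm out}\times d_{\rm in}}$, $b\in\mathbb{R}^{d_{\rm out}}$, $W^v_k\in\mathbb{C}^{d_{\rm out}\times d_{\rm in}}$ and $W^g\in\mathbb{R}^{d_{\rm out}\times(d\cdot d_{\rm in})}$ are parameters; $\rho(\cdot;\Omega)$ is a density function on $\Omega$; $\sigma$ is the GeLU activation function applied componentwise;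 and $\widetilde\nabla f_{\rm in}(x)=\mathrm{SoftSign}(\nabla f_{\rm in}(x))\in\mathbb{R}^{d\times d_{\rm in}}$, with $\mathrm{SoftSign}(s)=s/(1+|s|)$ componentwise, is the smoothed gradient, flattened to a vector in $\mathbb{R}^{d\cdot d_{\rm in}}$ before multiplication by $W^g$. Discretization on the point cloud. The point cloud consists of points $x^{(1)},\dots,x^{(N)}\in\Omega$ together with connectivity, i.e. a neighbor relation between points whose number of edges is $E$. The layer is evaluated at the $N$ points with the following discrete operators. Integral operator: since the Fourier kernel separates as $e^{2\pi \mathrm{i}\frac{k}{L}\cdot x}e^{-2\pi \mathrm{i}\frac{k}{L}\cdot y}$, the integral term is approximated by $$\sum_k e^{2\pi \mathrm{i}\frac{k}{L}\cdot x}\sum_{i=1}^N e^{-2\pi \mathrm{i}\frac{k}{L}\cdot x^{(i)}}\,W^v_k f_{\rm in}(x^{(i)})\,\rho(x^{(i)};\Omega)\,\mathrm{d}\Omega_i,$$ where $\mathrm{d}\Omega_i$ is the estimated mesh size associated with $x^{(i)}$, and $\rho(x^{(i)};\Omega)$ is either the uniform density $1/|\Omega|$ or the point cloud density $1/(N\,\mathrm{d}\Omega_i)$. Differential operator: for each channel of $f_{\rm in}$ separately, the gradient at a point $x$ of the cloud is computed by one message-passing step, $$\nabla f_{\rm in}(x)=\sum_{i:\,x^{(i)}\text{ is a neighbor of }x}A_i(x)^\dagger\bigl(f_{\rm in}(x^{(i)})-f_{\rm in}(x)\bigr),$$ where $A_i(x)^\dagger\in\mathbb{R}^d$ is the column,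 corresponding to the neighbor $x^{(i)}$, of the pseudoinverse of the matrix $A(x)$ whose rows are the differences $x^{(i)}-x$ over the neighbors $x^{(i)}$ of $x$ (if $\Omega$ is a submanifold of intrinsic dimension $d'\le d$, the pseudoinverse is computed from the rank-$d'$ truncated singular value decomposition of $A(x)$). These edge weights depend only on the point cloud and its connectivity and are precomputed, so their computation is not part of the inference cost. Inference cost means the computational complexity of evaluating the layer at all $N$ points from the values of $f_{\rm in}$ at these points.
   Formalization: The Fourier factors e^{±2πi(k/L)·x} at the cloud points are taken as available at unit cost per use, like the precomputed edge weights; computing them for k_max arbitrary frequencies in dimension d would exceed the stated bound. The real part of the integral term is taken. *)

theory Defs
  imports
    "HOL-Probability.Characteristic_Functions"
    "HOL-Library.Extended_Nat"
    "Jordan_Normal_Form.Matrix"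
begin

text \<open>
  All dimensions are natural-number parameters, so that one constant can be uniform in them:
  vectors and matrices are those of \<^theory>\<open>Jordan_Normal_Form.Matrix\<close>.
\<close>

unbundle no vec_syntax
hide_type (open) Finite_Cartesian_Product.vec
hide_const (open) Finite_Cartesian_Product.vec Finite_Cartesian_Product.mat
  Finite_Cartesian_Product.row Finite_Cartesian_Product.rows
  Finite_Cartesian_Product.transpose

section \<open>Activation functions\<close>

text \<open>\<^term>\<open>cdf std_normal_distribution\<close> is the distribution function of the standard normal law.\<close>

definition gelu :: "real \<Rightarrow> real" where
  "gelu s = s * cdf std_normal_distribution s"

definition softsign :: "real \<Rightarrow> real" where
  "softsign s = s / (1 + \<bar>s\<bar>)"

section \<open>Pseudoinverse of the truncated singular value decomposition\<close>

text \<open>The four Penrose conditions.\<close>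

definition is_pseudoinverse :: "real mat \<Rightarrow> real mat \<Rightarrow> bool" where
  "is_pseudoinverse A P \<longleftrightarrow>
     P \<in> carrier_mat (dim_col A) (dim_row A) \<and>
     A * P * A = A \<and> P * A * P = P \<and>
     transpose_mat (A * P) = A * P \<and> transpose_mat (P * A) = P * A"

text \<open>
  \<open>B\<close> is a rank-\<open>r\<close> truncated singular value decomposition of \<open>A\<close>. This is a relation, since
  \<open>B\<close> is not determined by \<open>A\<close> when the \<open>r\<close>-th and the next singular value coincide.
  If \<open>r\<close> is at least the number of columns of \<open>A\<close>, then \<open>B = A\<close>.
\<close>

definition is_truncated_svd :: "nat \<Rightarrow> real mat \<Rightarrow> real mat \<Rightarrow> bool" where
  "is_truncated_svd r A B \<longleftrightarrow>
     (let m = dim_row A; n = dim_col A in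
      \<exists>U V s. U \<in> carrier_mat m m \<and> transpose_mat U * U = 1\<^sub>m m \<and>
              V \<in> carrier_mat n n \<and> transpose_mat V * V = 1\<^sub>m n \<and>
              (\<forall>i. 0 \<le> s i) \<and> antimono (s :: nat \<Rightarrow> real) \<and>
              A = U * mat m n (\<lambda>(i, j). if i = j then s i else 0) * transpose_mat V \<and>
              B = U * mat m n (\<lambda>(i, j). if i = j \<and> i < r then s i else 0) * transpose_mat V)"

section \<open>Point clouds\<close>

text \<open>
  The connectivity is a set of ordered pairs of point indices, \<open>(j, i)\<close> meaning that point \<open>i\<close> is
  a neighbor of point \<open>j\<close>; an undirected graph is the case of a symmetric relation, each of its
  edges being counted twice. The neighbors of a point are enumerated in increasing order.
\<close>

definition neighbors :: "(nat \<times> nat) set \<Rightarrow> nat \<Rightarrow> nat list" where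
  "neighbors R j = sorted_list_of_set (R `` {j})"

text \<open>
  \<open>volume\<close> stands for the measure of \<open>domain\<close> (of the appropriate dimension \<open>intrinsic_dim\<close>) and
  \<open>mesh i\<close> for the estimated mesh size at point \<open>i\<close>; they enter only as positive numbers.
  Column \<open>t\<close> of \<open>pinv j\<close> is the weight of the edge from point \<open>j\<close> to its \<open>t\<close>-th neighbor.
\<close>

record point_cloud =
  domain :: "real vec set"
  volume :: real
  intrinsic_dim :: nat
  point :: "nat \<Rightarrow> real vec"
  mesh :: "nat \<Rightarrow> real"
  density :: "nat \<Rightarrow> real"
  pinv :: "nat \<Rightarrow> real mat"

definition difference_matrix ::
    "nat \<Rightarrow> (nat \<times> nat) set \<Rightarrow> (nat \<Rightarrow> real vec) \<Rightarrow> nat \<Rightarrow> real mat" where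
  "difference_matrix d R x j = mat_of_rows d (map (\<lambda>i. x i - x j) (neighbors R j))"

definition valid_cloud :: "nat \<Rightarrow> nat \<Rightarrow> (nat \<times> nat) set \<Rightarrow> point_cloud \<Rightarrow> bool" where
  "valid_cloud d N R X \<longleftrightarrow>
     domain X \<subseteq> carrier_vec d \<and> 0 < volume X \<and> intrinsic_dim X \<le> d \<and>
     (\<forall>i<N. point X i \<in> domain X \<and> 0 < mesh X i) \<and>
     ((\<forall>i<N. density X i = 1 / volume X) \<or> (\<forall>i<N. density X i = 1 / (real N * mesh X i))) \<and>
     (\<forall>j<N. \<exists>B. is_truncated_svd (intrinsic_dim X) (difference_matrix d R (point X) j) B \<and>
                is_pseudoinverse B (pinv X j))"

section \<open>The layer\<close>

record layer_params =
  local_weight :: "real mat"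
  bias :: "real vec"
  length_scale :: "real vec"
  frequencies :: "int vec list"
  fourier_weight :: "int vec \<Rightarrow> complex mat"
  gradient_weight :: "real mat"

text \<open>The set of frequencies is given by a list enumerating it without repetition.\<close>

definition valid_params :: "nat \<Rightarrow> nat \<Rightarrow> nat \<Rightarrow> nat \<Rightarrow> layer_params \<Rightarrow> bool" where
  "valid_params d d_in d_out k_max \<Theta> \<longleftrightarrow>
     local_weight \<Theta> \<in> carrier_mat d_out d_in \<and>
     bias \<Theta> \<in> carrier_vec d_out \<and>
     length_scale \<Theta> \<in> carrier_vec d \<and> (\<forall>a<d. 0 < length_scale \<Theta> $ a) \<and>
     set (frequencies \<Theta>) \<subseteq> carrier_vec d \<and> distinct (frequencies \<Theta>) \<and>
     length (frequencies \<Theta>) = k_max \<and>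
     (\<forall>k \<in> set (frequencies \<Theta>). fourier_weight \<Theta> k \<in> carrier_mat d_out d_in) \<and>
     gradient_weight \<Theta> \<in> carrier_mat d_out (d * d_in)"

definition phase :: "real vec \<Rightarrow> int vec \<Rightarrow> real vec \<Rightarrow> real" where
  "phase L k x = 2 * pi * scalar_prod (vec (dim_vec k) (\<lambda>a. of_int (k $ a) / L $ a)) x"

definition fourier_integral ::
    "nat \<Rightarrow> point_cloud \<Rightarrow> layer_params \<Rightarrow> (real vec \<Rightarrow> real vec) \<Rightarrow> nat \<Rightarrow> nat \<Rightarrow> complex" where
  "fourier_integral N X \<Theta> f j m =
     (\<Sum>k \<in> set (frequencies \<Theta>).
        exp (\<i> * of_real (phase (length_scale \<Theta>) k (point X j))) *
        (\<Sum>i<N. exp (- \<i> * of_real (phase (length_scale \<Theta>) k (point X i))) *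
                (fourier_weight \<Theta> k *\<^sub>v map_vec of_real (f (point X i))) $ m *
                of_real (density X i) * of_real (mesh X i)))"

definition gradient ::
    "(nat \<times> nat) set \<Rightarrow> point_cloud \<Rightarrow> (real vec \<Rightarrow> real vec) \<Rightarrow> nat \<Rightarrow> nat \<Rightarrow> nat \<Rightarrow> real" where
  "gradient R X f j a c =
     (\<Sum>t<length (neighbors R j).
        pinv X j $$ (a, t) * (f (point X (neighbors R j ! t)) $ c - f (point X j) $ c))"

text \<open>The \<open>d \<times> d_in\<close> matrix of smoothed partial derivatives, flattened row by row.\<close>

definition smoothed_gradient ::
    "nat \<Rightarrow> nat \<Rightarrow> (nat \<times> nat) set \<Rightarrow> point_cloud \<Rightarrow> (real vec \<Rightarrow> real vec) \<Rightarrow> nat \<Rightarrow> real vec" where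
  "smoothed_gradient d d_in R X f j =
     vec (d * d_in) (\<lambda>p. softsign (gradient R X f j (p div d_in) (p mod d_in)))"

text \<open>
  The real part makes the output real for arbitrary complex weights; it is the identity in the
  usual situation of conjugate-symmetric frequencies and weights.
\<close>

definition layer_output ::
    "nat \<Rightarrow> nat \<Rightarrow> nat \<Rightarrow> nat \<Rightarrow> (nat \<times> nat) set \<Rightarrow> point_cloud \<Rightarrow> layer_params \<Rightarrow>
     (real vec \<Rightarrow> real vec) \<Rightarrow> nat \<Rightarrow> real vec" where
  "layer_output d d_in d_out N R X \<Theta> f j =
     vec d_out (\<lambda>m. gelu
       ((local_weight \<Theta> *\<^sub>v f (point X j)) $ m + bias \<Theta> $ m +
        Re (fourier_integral N X \<Theta> f j m) +
        (gradient_weight \<Theta> *\<^sub>v smoothed_gradient d d_in R X f j) $ m))"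

section \<open>Cost model\<close>

text \<open>
  Straight-line programs over complex registers. Every instruction costs one unit and appends its
  result as a new register; this includes fetching a datum. The data are the values of the input
  function at the points, the parameters, and quantities that depend only on the cloud and the
  frequencies: edge weights, mesh sizes, densities and the Fourier factors. A Fourier factor
  thus costs one unit at each use, whether it is tabulated or evaluated; the \<open>d\<close> operations of the
  inner product in its phase are not counted.
\<close>

datatype datum =
    Input nat nat              \<comment> \<open>point, channel\<close>
  | Local_Weight nat nat
  | Bias nat
  | Fourier_Weight nat nat nat \<comment> \<open>frequency, row, column\<close>
  | Gradient_Weight nat nat
  | Fourier_Factor nat nat     \<comment> \<open>frequency, point\<close>
  | Inv_Fourier_Factor nat nat
  | Density nat
  | Mesh nat
  | Edge_Weight nat nat nat    \<comment> \<open>point, position in its list of neighbors, coordinate\<close>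

fun datum_value :: "point_cloud \<Rightarrow> layer_params \<Rightarrow> (real vec \<Rightarrow> real vec) \<Rightarrow> datum \<Rightarrow> complex" where
  "datum_value X \<Theta> f (Input j c) = of_real (f (point X j) $ c)"
| "datum_value X \<Theta> f (Local_Weight m c) = of_real (local_weight \<Theta> $$ (m, c))"
| "datum_value X \<Theta> f (Bias m) = of_real (bias \<Theta> $ m)"
| "datum_value X \<Theta> f (Fourier_Weight q m c) = fourier_weight \<Theta> (frequencies \<Theta> ! q) $$ (m, c)"
| "datum_value X \<Theta> f (Gradient_Weight m p) = of_real (gradient_weight \<Theta> $$ (m, p))"
| "datum_value X \<Theta> f (Fourier_Factor q j) =
     exp (\<i> * of_real (phase (length_scale \<Theta>) (frequencies \<Theta> ! q) (point X j)))"
| "datum_value X \<Theta> f (Inv_Fourier_Factor q j) =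
     exp (- \<i> * of_real (phase (length_scale \<Theta>) (frequencies \<Theta> ! q) (point X j)))"
| "datum_value X \<Theta> f (Density i) = of_real (density X i)"
| "datum_value X \<Theta> f (Mesh i) = of_real (mesh X i)"
| "datum_value X \<Theta> f (Edge_Weight j t a) = of_real (pinv X j $$ (a, t))"

datatype instruction =
    Load datum
  | Const complex
  | Add nat nat
  | Sub nat nat
  | Mul nat nat
  | Div nat nat
  | Real_Part nat
  | Gelu nat
  | Softsign nat

fun exec :: "(datum \<Rightarrow> complex) \<Rightarrow> complex list \<Rightarrow> instruction \<Rightarrow> complex" where
  "exec env rs (Load v) = env v"
| "exec env rs (Const z) = z"
| "exec env rs (Add a b) = rs ! a + rs ! b"
| "exec env rs (Sub a b) = rs ! a - rs ! b"
| "exec env rs (Mul a b) = rs ! a * rs ! b"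
| "exec env rs (Div a b) = rs ! a / rs ! b"
| "exec env rs (Real_Part a) = of_real (Re (rs ! a))"
| "exec env rs (Gelu a) = of_real (gelu (Re (rs ! a)))"
| "exec env rs (Softsign a) = of_real (softsign (Re (rs ! a)))"

definition run :: "(datum \<Rightarrow> complex) \<Rightarrow> instruction list \<Rightarrow> complex list" where
  "run env P = foldl (\<lambda>rs ins. rs @ [exec env rs ins]) [] P"

text \<open>
  A program may depend on the sizes and on the connectivity, but has to be correct for all point
  clouds, all parameters and all input functions. Register \<open>out j m\<close> holds component \<open>m\<close> of the
  output at point \<open>j\<close>.
\<close>

definition evaluates_layer ::
    "nat \<Rightarrow> nat \<Rightarrow> nat \<Rightarrow> nat \<Rightarrow> nat \<Rightarrow> (nat \<times> nat) set \<Rightarrow> instruction list \<Rightarrow> bool" where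
  "evaluates_layer d d_in d_out k_max N R P \<longleftrightarrow>
     (\<exists>out. \<forall>j<N. \<forall>m<d_out. out j m < length P \<and>
        (\<forall>X \<Theta> f. valid_cloud d N R X \<and> valid_params d d_in d_out k_max \<Theta> \<and>
                 f \<in> domain X \<rightarrow> carrier_vec d_in \<longrightarrow>
           run (datum_value X \<Theta> f) P ! out j m =
             of_real (layer_output d d_in d_out N R X \<Theta> f j $ m)))"

text \<open>The infimum is \<open>\<infinity>\<close> if no program evaluates the layer.\<close>

definition inference_cost ::
    "nat \<Rightarrow> nat \<Rightarrow> nat \<Rightarrow> nat \<Rightarrow> nat \<Rightarrow> (nat \<times> nat) set \<Rightarrow> enat" where
  "inference_cost d d_in d_out k_max N R =
     (INF P \<in> {P. evaluates_layer d d_in d_out k_max N R P}. enat (length P))"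

end

theory Submission
  imports Defs
begin

text \<open>
  The bound rests on the separability of the Fourier kernel. The integral term at point \<open>j\<close> and
  channel \<open>m\<close> is
  \[ \sum_k e_k(x_j) \sum_i \overline{e_k(x_i)} \sum_c W_k(m,c)\, f_c(x_i)\, \rho_i\, \mu_i
     = \sum_k e_k(x_j) \Bigl( \sum_c W_k(m,c)
         \Bigl( \sum_i \overline{e_k(x_i)}\, f_c(x_i)\, \rho_i\, \mu_i \Bigr) \Bigr). \]
  The innermost sum on the right depends only on the frequency and the input channel; the sum
  around it depends only on the frequency and the output channel. Computing each of these
  once and keeping the results costs of the order of \<open>N * d_in * k_max\<close>, \<open>d_in * d_out * k_max\<close> and
  \<open>N * d_out * k_max\<close> operations for the three levels, in place of the \<open>N\<^sup>2\<close> of a dense kernel.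
  Likewise the smoothed partial derivatives at a point are shared by all output channels: since the
  degrees in the connectivity add up to \<open>E\<close>, they cost of the order of \<open>(E + N) * d * d_in\<close> in
  total, and multiplying them by the gradient weights costs \<open>N * d_out * d * d_in\<close>. The local term
  costs \<open>N * d_in * d_out\<close>.

  To turn this count into a straight-line program without handling register numbers, the relation
  \<open>derivable\<close> says that some quantities can be obtained from others by at most \<open>n\<close> further
  instructions; it is closed under the arithmetic operations, finite sums, families and
  composition (\<open>derivable_sum\<close>, \<open>derivable_image\<close>, \<open>derivable_trans\<close>). The lemmas
  \<open>derivable_moments\<close>, \<open>derivable_mixed_moments\<close>, \<open>derivable_gradient_features\<close> and
  \<open>derivable_outputs\<close> give the cost of each stage, \<open>fourier_integral_eq_mixed_moments\<close> is the
  exchange of summations above, and \<open>stage_costs_le\<close> adds up the costs.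
\<close>

section \<open>A cost calculus for straight-line programs\<close>

text \<open>
  A quantity is regarded as a function of the data, so that a register holds it only if it does so
  for all values of the data at once.
\<close>

type_synonym quantity = "(datum \<Rightarrow> complex) \<Rightarrow> complex"

definition available :: "instruction list \<Rightarrow> quantity set" where
  "available P = {v. \<exists>r < length P. \<forall>e. run e P ! r = v e}"

text \<open>
  Quantifying over all programs \<open>P\<close> that hold \<open>V\<close> makes the relation compositional: several
  derivations from the same \<open>V\<close> can be run one after the other, wherever their operands are stored.
\<close>

definition derivable :: "quantity set \<Rightarrow> quantity set \<Rightarrow> nat \<Rightarrow> bool" where
  "derivable V W n \<longleftrightarrow>
     (\<forall>P. V \<subseteq> available P \<longrightarrow> (\<exists>Q. length Q \<le> n \<and> W \<subseteq> available (P @ Q)))"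

lemma run_snoc: "run e (P @ [ins]) = run e P @ [exec e (run e P) ins]"
  by (simp add: run_def)

lemma length_run [simp]: "length (run e P) = length P"
  by (induction P rule: rev_induct) (simp_all add: run_snoc, simp add: run_def)

lemma nth_run_append: "r < length P \<Longrightarrow> run e (P @ Q) ! r = run e P ! r"
proof (induction Q rule: rev_induct)
  case (snoc ins Q)
  then show ?case using run_snoc[of e "P @ Q" ins] by (simp add: nth_append)
qed simp

lemma available_append: "available P \<subseteq> available (P @ Q)"
proof
  fix v assume "v \<in> available P"
  then obtain r where "r < length P" "\<forall>e. run e P ! r = v e"
    unfolding available_def by blast
  then show "v \<in> available (P @ Q)"
    unfolding available_def by (auto simp: nth_run_append intro!: exI[of _ r])
qed

lemma available_snoc: "(\<lambda>e. exec e (run e P) ins) \<in> available (P @ [ins])"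
  unfolding available_def
  by (auto simp: run_snoc nth_append intro!: exI[of _ "length P"])

lemma derivable_mono:
  assumes "derivable V W n" "V \<subseteq> V'" "W' \<subseteq> W" "n \<le> n'"
  shows "derivable V' W' n'"
  using assms unfolding derivable_def by (meson order_trans)

lemma derivable_mem: "v \<in> V \<Longrightarrow> derivable V {v} 0"
  unfolding derivable_def by auto

lemma derivable_trans:
  assumes "derivable V W n" "derivable W U m"
  shows "derivable V U (n + m)"
  unfolding derivable_def
proof (intro allI impI)
  fix P assume "V \<subseteq> available P"
  then obtain Q where Q: "length Q \<le> n" "W \<subseteq> available (P @ Q)"
    using assms(1) unfolding derivable_def by blast
  then obtain Q' where Q': "length Q' \<le> m" "U \<subseteq> available ((P @ Q) @ Q')"
    using assms(2) unfolding derivable_def by blast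
  show "\<exists>Q. length Q \<le> n + m \<and> U \<subseteq> available (P @ Q)"
    using Q Q' by (intro exI[of _ "Q @ Q'"]) simp
qed

lemma derivable_Un:
  assumes "derivable V W n" "derivable V U m"
  shows "derivable V (W \<union> U) (n + m)"
  unfolding derivable_def
proof (intro allI impI)
  fix P assume P: "V \<subseteq> available P"
  then obtain Q where Q: "length Q \<le> n" "W \<subseteq> available (P @ Q)"
    using assms(1) unfolding derivable_def by blast
  have "V \<subseteq> available (P @ Q)"
    using P available_append by blast
  then obtain Q' where Q': "length Q' \<le> m" "U \<subseteq> available ((P @ Q) @ Q')"
    using assms(2) unfolding derivable_def by blast
  have "W \<subseteq> available ((P @ Q) @ Q')"
    using Q(2) available_append by blast
  then show "\<exists>Q. length Q \<le> n + m \<and> W \<union> U \<subseteq> available (P @ Q)"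
    using Q(1) Q' by (intro exI[of _ "Q @ Q'"]) simp
qed

lemma derivable_image:
  assumes "finite I" "\<And>i. i \<in> I \<Longrightarrow> derivable V {g i} (n i)"
  shows "derivable V (g ` I) (sum n I)"
  using assms
proof (induction I rule: finite_induct)
  case empty
  show ?case by (simp add: derivable_def exI[of _ "[]"])
next
  case (insert i I)
  then show ?case using derivable_Un[of V "{g i}" "n i" "g ` I" "sum n I"] by simp
qed

subsection \<open>Single instructions\<close>

lemma derivable_load: "derivable V {\<lambda>e. e x} 1"
  unfolding derivable_def
proof (intro allI impI)
  fix P
  show "\<exists>Q. length Q \<le> 1 \<and> {\<lambda>e. e x} \<subseteq> available (P @ Q)"
    using available_snoc[of P "Load x"] by (intro exI[of _ "[Load x]"]) simp
qed

lemma derivable_const: "derivable V {\<lambda>e. z} 1"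
  unfolding derivable_def
proof (intro allI impI)
  fix P
  show "\<exists>Q. length Q \<le> 1 \<and> {\<lambda>e. z} \<subseteq> available (P @ Q)"
    using available_snoc[of P "Const z"] by (intro exI[of _ "[Const z]"]) simp
qed

lemma derivable_unary:
  assumes "\<And>e rs a. exec e rs (ins a) = h (rs ! a)" "derivable V {v} n"
  shows "derivable V {\<lambda>e. h (v e)} (n + 1)"
proof (rule derivable_trans[OF assms(2)])
  show "derivable {v} {\<lambda>e. h (v e)} 1"
    unfolding derivable_def
  proof (intro allI impI)
    fix P assume "{v} \<subseteq> available P"
    then obtain r where "\<forall>e. run e P ! r = v e"
      unfolding available_def by auto
    then show "\<exists>Q. length Q \<le> 1 \<and> {\<lambda>e. h (v e)} \<subseteq> available (P @ Q)"
      using available_snoc[of P "ins r"] by (intro exI[of _ "[ins r]"]) (simp add: assms(1))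
  qed
qed

lemma derivable_binary:
  assumes "\<And>e rs a b. exec e rs (ins a b) = h (rs ! a) (rs ! b)"
    and "derivable V {v} n" "derivable V {w} m"
  shows "derivable V {\<lambda>e. h (v e) (w e)} (n + m + 1)"
proof (rule derivable_trans[OF derivable_Un[OF assms(2,3)]])
  show "derivable ({v} \<union> {w}) {\<lambda>e. h (v e) (w e)} 1"
    unfolding derivable_def
  proof (intro allI impI)
    fix P assume "{v} \<union> {w} \<subseteq> available P"
    then obtain r s where "\<forall>e. run e P ! r = v e" "\<forall>e. run e P ! s = w e"
      unfolding available_def by auto
    then show "\<exists>Q. length Q \<le> 1 \<and> {\<lambda>e. h (v e) (w e)} \<subseteq> available (P @ Q)"
      using available_snoc[of P "ins r s"] by (intro exI[of _ "[ins r s]"]) (simp add: assms(1))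
  qed
qed

lemmas derivable_add = derivable_binary[where ins = Add and h = "(+)", OF exec.simps(3)]
lemmas derivable_diff = derivable_binary[where ins = Sub and h = "(-)", OF exec.simps(4)]
lemmas derivable_mult = derivable_binary[where ins = Mul and h = "(*)", OF exec.simps(5)]
lemmas derivable_gelu =
  derivable_unary[where ins = Gelu and h = "\<lambda>z. of_real (gelu (Re z))", OF exec.simps(8)]
lemmas derivable_softsign =
  derivable_unary[where ins = Softsign and h = "\<lambda>z. of_real (softsign (Re z))", OF exec.simps(9)]

text \<open>The extra unit is for the constant \<open>0\<close> with which the accumulation starts.\<close>

lemma derivable_sum:
  assumes "finite I" "\<And>i. i \<in> I \<Longrightarrow> derivable V {t i} n"
  shows "derivable V {\<lambda>e. \<Sum>i\<in>I. t i e} (card I * (n + 1) + 1)"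
  using assms
proof (induction I rule: finite_induct)
  case empty
  show ?case using derivable_const[of V 0] by simp
next
  case (insert i I)
  then have "derivable V {\<lambda>e. t i e + (\<Sum>i\<in>I. t i e)} (n + (card I * (n + 1) + 1) + 1)"
    by (intro derivable_add) auto
  then show ?case using insert.hyps by (simp add: algebra_simps)
qed

lemma derivable_load_mult:
  assumes "derivable V {v} n"
  shows "derivable V {\<lambda>e. e x * v e} (n + 2)"
  using derivable_mult[OF derivable_load[of V x] assms] by simp

text \<open>
  A program of length \<open>n\<close> exists as soon as all outputs are derivable from nothing, since the empty
  program holds the empty set of quantities.
\<close>

lemma inference_cost_le:
  assumes "derivable {} (case_prod out ` ({..<N} \<times> {..<d_out})) n"
    and "\<And>j m X \<Theta> f. j < N \<Longrightarrow> m < d_out \<Longrightarrow> valid_cloud d N R X \<Longrightarrow>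
           valid_params d d_in d_out k_max \<Theta> \<Longrightarrow> f \<in> domain X \<rightarrow> carrier_vec d_in \<Longrightarrow>
           out j m (datum_value X \<Theta> f) = of_real (layer_output d d_in d_out N R X \<Theta> f j $ m)"
  shows "inference_cost d d_in d_out k_max N R \<le> enat n"
proof -
  obtain P where P: "length P \<le> n" "case_prod out ` ({..<N} \<times> {..<d_out}) \<subseteq> available P"
    using assms(1) unfolding derivable_def by (metis append_Nil empty_subsetI)
  have "\<exists>r < length P. \<forall>e. run e P ! r = out j m e" if "j < N" "m < d_out" for j m
    using P(2) that unfolding available_def by (auto simp: image_subset_iff)
  then obtain reg where reg: "\<And>j m. j < N \<Longrightarrow> m < d_out \<Longrightarrow>
      reg j m < length P \<and> (\<forall>e. run e P ! reg j m = out j m e)"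
    by metis
  have "evaluates_layer d d_in d_out k_max N R P"
    unfolding evaluates_layer_def using reg assms(2) by (intro exI[of _ reg]) simp
  then have "inference_cost d d_in d_out k_max N R \<le> enat (length P)"
    unfolding inference_cost_def by (intro INF_lower) simp
  also have "\<dots> \<le> enat n"
    using P(1) by simp
  finally show ?thesis .
qed

section \<open>The intermediate quantities\<close>

text \<open>The discrete Fourier coefficients of the input, before and after mixing the channels.\<close>

definition moment :: "nat \<Rightarrow> nat \<Rightarrow> nat \<Rightarrow> quantity" where
  "moment N q c = (\<lambda>e. \<Sum>i<N.
     e (Inv_Fourier_Factor q i) * (e (Density i) * (e (Mesh i) * e (Input i c))))"

definition mixed_moment :: "nat \<Rightarrow> nat \<Rightarrow> nat \<Rightarrow> nat \<Rightarrow> quantity" where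
  "mixed_moment N d_in q m = (\<lambda>e. \<Sum>c<d_in. e (Fourier_Weight q m c) * moment N q c e)"

text \<open>The index \<open>p\<close> runs through the flattened gradient, row by row.\<close>

definition gradient_feature :: "nat \<Rightarrow> (nat \<times> nat) set \<Rightarrow> nat \<Rightarrow> nat \<Rightarrow> quantity" where
  "gradient_feature d_in R j p = (\<lambda>e. of_real (softsign (Re
     (\<Sum>t<length (neighbors R j). e (Edge_Weight j t (p div d_in)) *
        (e (Input (neighbors R j ! t) (p mod d_in)) - e (Input j (p mod d_in)))))))"

definition preactivation ::
    "nat \<Rightarrow> nat \<Rightarrow> nat \<Rightarrow> nat \<Rightarrow> (nat \<times> nat) set \<Rightarrow> nat \<Rightarrow> nat \<Rightarrow> quantity" where
  "preactivation d d_in k_max N R j m = (\<lambda>e.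
     (\<Sum>c<d_in. e (Local_Weight m c) * e (Input j c)) + e (Bias m) +
     (\<Sum>q<k_max. e (Fourier_Factor q j) * mixed_moment N d_in q m e) +
     (\<Sum>p<d * d_in. e (Gradient_Weight m p) * gradient_feature d_in R j p e))"

definition activation ::
    "nat \<Rightarrow> nat \<Rightarrow> nat \<Rightarrow> nat \<Rightarrow> (nat \<times> nat) set \<Rightarrow> nat \<Rightarrow> nat \<Rightarrow> quantity" where
  "activation d d_in k_max N R j m =
     (\<lambda>e. of_real (gelu (Re (preactivation d d_in k_max N R j m e))))"

section \<open>Correctness\<close>

lemma index_mult_mat_vec_sum:
  assumes "A \<in> carrier_mat nr nc" "v \<in> carrier_vec nc" "m < nr"
  shows "(A *\<^sub>v v) $ m = (\<Sum>c<nc. A $$ (m, c) * v $ c)"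
  using assms by (simp add: scalar_prod_def atLeast0LessThan)

lemma fourier_integral_eq_mixed_moments:
  assumes "valid_cloud d N R X" "valid_params d d_in d_out k_max \<Theta>"
    and "f \<in> domain X \<rightarrow> carrier_vec d_in" "m < d_out"
  shows "fourier_integral N X \<Theta> f j m =
    (\<Sum>q<k_max. datum_value X \<Theta> f (Fourier_Factor q j) *
       mixed_moment N d_in q m (datum_value X \<Theta> f))"
proof -
  let ?e = "datum_value X \<Theta> f"
  define k where "k = (\<lambda>q. frequencies \<Theta> ! q)"
  have bij: "bij_betw k {..<k_max} (set (frequencies \<Theta>))"
    using assms(2) bij_betw_nth[of "frequencies \<Theta>" "{..<k_max}" "set (frequencies \<Theta>)"]
    by (simp add: valid_params_def k_def[abs_def])
  have f: "f (point X i) \<in> carrier_vec d_in" if "i < N" for i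
    using assms(1,3) that by (auto simp: valid_cloud_def)
  have term_eq: "?e (Inv_Fourier_Factor q i) *
        (fourier_weight \<Theta> (k q) *\<^sub>v map_vec of_real (f (point X i))) $ m *
        of_real (density X i) * of_real (mesh X i) =
      (\<Sum>c<d_in. ?e (Fourier_Weight q m c) * (?e (Inv_Fourier_Factor q i) *
        (?e (Density i) * (?e (Mesh i) * ?e (Input i c)))))"
    if "q < k_max" "i < N" for q i
  proof -
    have "k q \<in> set (frequencies \<Theta>)"
      using bij that(1) by (auto simp: bij_betw_def)
    then have "fourier_weight \<Theta> (k q) \<in> carrier_mat d_out d_in"
      using assms(2) by (simp add: valid_params_def)
    then have "(fourier_weight \<Theta> (k q) *\<^sub>v map_vec of_real (f (point X i))) $ m =
        (\<Sum>c<d_in. fourier_weight \<Theta> (k q) $$ (m, c) * of_real (f (point X i) $ c))"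
      using f[OF that(2)] assms(4) by (subst index_mult_mat_vec_sum) auto
    then show ?thesis
      by (simp add: k_def sum_distrib_left sum_distrib_right mult_ac)
  qed
  have "fourier_integral N X \<Theta> f j m =
      (\<Sum>q<k_max. ?e (Fourier_Factor q j) * (\<Sum>i<N. ?e (Inv_Fourier_Factor q i) *
        (fourier_weight \<Theta> (k q) *\<^sub>v map_vec of_real (f (point X i))) $ m *
        of_real (density X i) * of_real (mesh X i)))"
    unfolding fourier_integral_def sum.reindex_bij_betw[OF bij, symmetric] by (simp add: k_def)
  also have "\<dots> = (\<Sum>q<k_max. ?e (Fourier_Factor q j) * mixed_moment N d_in q m ?e)"
  proof (intro sum.cong arg_cong2[of _ _ _ _ "(*)"] refl)
    fix q assume "q \<in> {..<k_max}"
    then have "(\<Sum>i<N. ?e (Inv_Fourier_Factor q i) *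
        (fourier_weight \<Theta> (k q) *\<^sub>v map_vec of_real (f (point X i))) $ m *
        of_real (density X i) * of_real (mesh X i)) =
      (\<Sum>i<N. \<Sum>c<d_in. ?e (Fourier_Weight q m c) * (?e (Inv_Fourier_Factor q i) *
        (?e (Density i) * (?e (Mesh i) * ?e (Input i c)))))"
      using term_eq by (intro sum.cong) auto
    also have "\<dots> = mixed_moment N d_in q m ?e"
      unfolding mixed_moment_def moment_def sum_distrib_left by (rule sum.swap)
    finally show "(\<Sum>i<N. ?e (Inv_Fourier_Factor q i) *
        (fourier_weight \<Theta> (k q) *\<^sub>v map_vec of_real (f (point X i))) $ m *
        of_real (density X i) * of_real (mesh X i)) = mixed_moment N d_in q m ?e" .
  qed
  finally show ?thesis .
qed

lemma gradient_feature_eq: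
  "gradient_feature d_in R j p (datum_value X \<Theta> f) =
     of_real (softsign (gradient R X f j (p div d_in) (p mod d_in)))"
  by (simp add: gradient_feature_def gradient_def)

text \<open>
  All terms other than the Fourier integral are real, so that taking the real part of the whole sum,
  as the activation instruction does, takes it of the Fourier integral alone.
\<close>

lemma preactivation_correct:
  assumes "valid_cloud d N R X" "valid_params d d_in d_out k_max \<Theta>"
    and "f \<in> domain X \<rightarrow> carrier_vec d_in" "j < N" "m < d_out"
  shows "Re (preactivation d d_in k_max N R j m (datum_value X \<Theta> f)) =
    (local_weight \<Theta> *\<^sub>v f (point X j)) $ m + bias \<Theta> $ m + Re (fourier_integral N X \<Theta> f j m) +
    (gradient_weight \<Theta> *\<^sub>v smoothed_gradient d d_in R X f j) $ m"
proof -
  have "f (point X j) \<in> carrier_vec d_in"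
    using assms(1,3,4) by (auto simp: valid_cloud_def)
  then have "(local_weight \<Theta> *\<^sub>v f (point X j)) $ m =
      (\<Sum>c<d_in. local_weight \<Theta> $$ (m, c) * f (point X j) $ c)"
    using assms(2,5) by (intro index_mult_mat_vec_sum) (auto simp: valid_params_def)
  moreover have "(gradient_weight \<Theta> *\<^sub>v smoothed_gradient d d_in R X f j) $ m =
      (\<Sum>p<d * d_in. gradient_weight \<Theta> $$ (m, p) * smoothed_gradient d d_in R X f j $ p)"
    using assms(2,5)
    by (intro index_mult_mat_vec_sum) (auto simp: valid_params_def smoothed_gradient_def)
  ultimately show ?thesis
    by (simp add: preactivation_def fourier_integral_eq_mixed_moments[OF assms(1-3,5)]
        gradient_feature_eq smoothed_gradient_def del: index_mult_mat_vec)
qed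

lemma activation_correct:
  assumes "valid_cloud d N R X" "valid_params d d_in d_out k_max \<Theta>"
    and "f \<in> domain X \<rightarrow> carrier_vec d_in" "j < N" "m < d_out"
  shows "activation d d_in k_max N R j m (datum_value X \<Theta> f) =
    of_real (layer_output d d_in d_out N R X \<Theta> f j $ m)"
  using assms(5) by (simp add: activation_def layer_output_def preactivation_correct[OF assms]
      del: index_mult_mat_vec)

section \<open>Cost of the stages\<close>

lemma derivable_moments:
  "derivable {} (case_prod (moment N) ` ({..<k_max} \<times> {..<d_in})) (k_max * d_in * (N * 8 + 1))"
proof -
  have "derivable {} {moment N q c} (N * 8 + 1)" for q c
  proof -
    have "derivable {} {\<lambda>e. e (Inv_Fourier_Factor q i) *
        (e (Density i) * (e (Mesh i) * e (Input i c)))} (1 + 2 + 2 + 2)" for i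
      by (intro derivable_load_mult derivable_load)
    then have "derivable {} {\<lambda>e. \<Sum>i<N. e (Inv_Fourier_Factor q i) *
        (e (Density i) * (e (Mesh i) * e (Input i c)))} (card {..<N} * ((1 + 2 + 2 + 2) + 1) + 1)"
      by (intro derivable_sum) auto
    then show ?thesis
      by (elim derivable_mono) (simp_all add: moment_def)
  qed
  then have "derivable {} (case_prod (moment N) ` ({..<k_max} \<times> {..<d_in}))
      (\<Sum>x\<in>{..<k_max} \<times> {..<d_in}. N * 8 + 1)"
    by (intro derivable_image) auto
  then show ?thesis
    by (simp add: algebra_simps)
qed

lemma derivable_mixed_moments:
  "derivable (case_prod (moment N) ` ({..<k_max} \<times> {..<d_in}))
     (case_prod (mixed_moment N d_in) ` ({..<k_max} \<times> {..<d_out}))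
     (k_max * d_out * (d_in * 3 + 1))"
proof -
  let ?V = "case_prod (moment N) ` ({..<k_max} \<times> {..<d_in})"
  have "derivable ?V {mixed_moment N d_in q m} (d_in * 3 + 1)" if "q < k_max" for q m
  proof -
    have "derivable ?V {\<lambda>e. e (Fourier_Weight q m c) * moment N q c e} (0 + 2)" if "c < d_in" for c
      using \<open>q < k_max\<close> that by (intro derivable_load_mult derivable_mem) auto
    then have "derivable ?V {\<lambda>e. \<Sum>c<d_in. e (Fourier_Weight q m c) * moment N q c e}
        (card {..<d_in} * ((0 + 2) + 1) + 1)"
      by (intro derivable_sum) auto
    then show ?thesis
      by (elim derivable_mono) (simp_all add: mixed_moment_def)
  qed
  then have "derivable ?V (case_prod (mixed_moment N d_in) ` ({..<k_max} \<times> {..<d_out}))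
      (\<Sum>x\<in>{..<k_max} \<times> {..<d_out}. d_in * 3 + 1)"
    by (intro derivable_image) auto
  then show ?thesis
    by (simp add: algebra_simps)
qed

lemma sum_length_neighbors:
  assumes "R \<subseteq> {..<N} \<times> {..<N}"
  shows "(\<Sum>j<N. length (neighbors R j)) = card R"
proof -
  have fin: "finite (R `` {j})" for j
    by (rule finite_subset[of _ "{..<N}"]) (use assms in auto)
  have "R = (SIGMA j:{..<N}. R `` {j})"
    using assms by auto
  then have "card R = (\<Sum>j<N. card (R `` {j}))"
    using card_SigmaI[of "{..<N}" "\<lambda>j. R `` {j}"] fin by simp
  then show ?thesis
    by (simp add: neighbors_def)
qed

lemma derivable_gradient_features:
  assumes "R \<subseteq> {..<N} \<times> {..<N}"
  shows "derivable {} (case_prod (gradient_feature d_in R) ` ({..<N} \<times> {..<d * d_in}))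
    (d * d_in * (card R * 6 + N * 2))"
proof -
  have single: "derivable {} {gradient_feature d_in R j p} (length (neighbors R j) * 6 + 2)" for j p
  proof -
    have "derivable {} {\<lambda>e. e (Edge_Weight j t (p div d_in)) *
        (e (Input (neighbors R j ! t) (p mod d_in)) - e (Input j (p mod d_in)))} (1 + 1 + 1 + 2)" for t
      by (intro derivable_load_mult derivable_diff derivable_load)
    then have "derivable {} {\<lambda>e. \<Sum>t<length (neighbors R j). e (Edge_Weight j t (p div d_in)) *
        (e (Input (neighbors R j ! t) (p mod d_in)) - e (Input j (p mod d_in)))}
        (card {..<length (neighbors R j)} * ((1 + 1 + 1 + 2) + 1) + 1)"
      by (intro derivable_sum) auto
    from derivable_softsign[OF this] show ?thesis
      by (elim derivable_mono) (simp_all add: gradient_feature_def)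
  qed
  have "derivable {} (case_prod (gradient_feature d_in R) ` ({..<N} \<times> {..<d * d_in}))
      (\<Sum>(j, p)\<in>{..<N} \<times> {..<d * d_in}. length (neighbors R j) * 6 + 2)"
    using single by (intro derivable_image) auto
  moreover have "(\<Sum>(j, p)\<in>{..<N} \<times> {..<d * d_in}. length (neighbors R j) * 6 + 2) =
      d * d_in * (card R * 6 + N * 2)"
    by (simp add: sum.cartesian_product[symmetric] sum.distrib sum_distrib_left[symmetric]
        sum_distrib_right[symmetric] sum_length_neighbors[OF assms] algebra_simps)
  ultimately show ?thesis
    by simp
qed

lemma derivable_outputs:
  "derivable
     (case_prod (mixed_moment N d_in) ` ({..<k_max} \<times> {..<d_out}) \<union>
      case_prod (gradient_feature d_in R) ` ({..<N} \<times> {..<d * d_in}))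
     (case_prod (activation d d_in k_max N R) ` ({..<N} \<times> {..<d_out}))
     (N * d_out * (d_in * 4 + k_max * 3 + d * d_in * 3 + 8))"
    (is "derivable ?V _ _")
proof -
  have single: "derivable ?V {activation d d_in k_max N R j m}
      (d_in * 4 + k_max * 3 + d * d_in * 3 + 8)" if "j < N" "m < d_out" for j m
  proof -
    have "derivable ?V {\<lambda>e. \<Sum>c<d_in. e (Local_Weight m c) * e (Input j c)}
        (card {..<d_in} * ((1 + 2) + 1) + 1)"
      by (intro derivable_sum derivable_load_mult derivable_load) auto
    moreover have "derivable ?V {\<lambda>e. \<Sum>q<k_max. e (Fourier_Factor q j) * mixed_moment N d_in q m e}
        (card {..<k_max} * ((0 + 2) + 1) + 1)"
      using that by (intro derivable_sum derivable_load_mult derivable_mem) auto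
    moreover have "derivable ?V
        {\<lambda>e. \<Sum>p<d * d_in. e (Gradient_Weight m p) * gradient_feature d_in R j p e}
        (card {..<d * d_in} * ((0 + 2) + 1) + 1)"
      using that by (intro derivable_sum derivable_load_mult derivable_mem) auto
    ultimately have "derivable ?V {preactivation d d_in k_max N R j m}
        ((((card {..<d_in} * ((1 + 2) + 1) + 1) + 1 + 1) +
          (card {..<k_max} * ((0 + 2) + 1) + 1) + 1) +
          (card {..<d * d_in} * ((0 + 2) + 1) + 1) + 1)"
      unfolding preactivation_def by (intro derivable_add derivable_load)
    from derivable_gelu[OF this] show ?thesis
      by (elim derivable_mono) (simp_all add: activation_def)
  qed
  have "derivable ?V (case_prod (activation d d_in k_max N R) ` ({..<N} \<times> {..<d_out}))
      (\<Sum>x\<in>{..<N} \<times> {..<d_out}. d_in * 4 + k_max * 3 + d * d_in * 3 + 8)"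
    using single by (intro derivable_image) auto
  then show ?thesis
    by (simp add: algebra_simps)
qed

text \<open>
  As the dimensions are positive, factors missing from a term can be supplied: every term without
  \<open>E\<close> is at most its coefficient times \<open>N * d_in * d_out * k_max\<close> or \<open>N * d_in * d_out * d\<close>. The
  constant bounds the sums of the coefficients:
  \<open>9 + 4 + 3\<close> for \<open>k_max\<close>, \<open>2 + 4 + 3 + 8\<close> for \<open>d\<close>, and \<open>6\<close> for the edges.
\<close>

lemma stage_costs_le:
  fixes d d_in d_out k_max N E :: nat
  assumes "1 \<le> d" "1 \<le> d_in" "1 \<le> d_out" "1 \<le> N"
  shows "k_max * d_in * (N * 8 + 1) + k_max * d_out * (d_in * 3 + 1) +
      d * d_in * (E * 6 + N * 2) + N * d_out * (d_in * 4 + k_max * 3 + d * d_in * 3 + 8)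
    \<le> 17 * (N * d_in * d_out * (k_max + d) + E * d_in * d)"
proof -
  let ?K = "N * d_in * d_out * k_max" and ?D = "N * d_in * d_out * d"
  have moments: "k_max * d_in * (N * 8 + 1) \<le> 9 * ?K"
  proof -
    have "k_max * d_in * (N * 8 + 1) \<le> k_max * d_in * ((N * 9) * d_out)"
    proof (intro mult_left_mono)
      have "N * 9 * 1 \<le> N * 9 * d_out"
        using assms by (intro mult_left_mono) auto
      then show "N * 8 + 1 \<le> N * 9 * d_out"
        using assms by linarith
    qed simp
    then show ?thesis by (simp add: mult_ac)
  qed
  have mixed: "k_max * d_out * (d_in * 3 + 1) \<le> 4 * ?K"
  proof -
    have "k_max * d_out * (d_in * 3 + 1) \<le> k_max * d_out * ((d_in * 4) * N)"
    proof (intro mult_left_mono)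
      have "d_in * 4 * 1 \<le> d_in * 4 * N"
        using assms by (intro mult_left_mono) auto
      then show "d_in * 3 + 1 \<le> d_in * 4 * N"
        using assms by linarith
    qed simp
    then show ?thesis by (simp add: mult_ac)
  qed
  have gradients: "d * d_in * (E * 6 + N * 2) \<le> 6 * (E * d_in * d) + 2 * ?D"
    using assms mult_left_mono[of 1 d_out "d * d_in * N"] by (simp add: algebra_simps)
  have outputs: "N * d_out * (d_in * 4 + k_max * 3 + d * d_in * 3 + 8) \<le> 15 * ?D + 3 * ?K"
  proof -
    have "d_in * 1 \<le> d_in * d" "k_max * 1 \<le> k_max * d_in" "1 * 1 \<le> d_in * d"
      using assms by (intro mult_mono; simp)+
    then have "d_in * 4 + k_max * 3 + d * d_in * 3 + 8 \<le> 15 * (d_in * d) + 3 * (k_max * d_in)"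
      unfolding mult.commute[of d d_in] by linarith
    from mult_left_mono[OF this, of "N * d_out"] show ?thesis
      by (simp add: algebra_simps)
  qed
  show ?thesis
    unfolding distrib_left[of "N * d_in * d_out"] distrib_left[of 17]
    using moments mixed gradients outputs by linarith
qed

theorem theorem2:
  fixes c :: real
  shows "\<exists>C::nat. \<forall>d d_in d_out k_max N E R.
           1 \<le> d \<and> 1 \<le> d_in \<and> 1 \<le> d_out \<and> 1 \<le> N \<and>
           R \<subseteq> {..<N} \<times> {..<N} \<and> E = card R \<and> real E \<le> c * real N \<longrightarrow>
           inference_cost d d_in d_out k_max N R
             \<le> enat (C * (N * d_in * d_out * (k_max + d) + E * d_in * d))"
proof (intro exI[of _ 17] allI impI)
  fix d d_in d_out k_max N E :: nat and R :: "(nat \<times> nat) set"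
  assume A: "1 \<le> d \<and> 1 \<le> d_in \<and> 1 \<le> d_out \<and> 1 \<le> N \<and>
    R \<subseteq> {..<N} \<times> {..<N} \<and> E = card R \<and> real E \<le> c * real N"
  have "derivable {} (case_prod (activation d d_in k_max N R) ` ({..<N} \<times> {..<d_out}))
      (k_max * d_in * (N * 8 + 1) + k_max * d_out * (d_in * 3 + 1) +
       d * d_in * (E * 6 + N * 2) + N * d_out * (d_in * 4 + k_max * 3 + d * d_in * 3 + 8))"
    using derivable_trans[OF derivable_Un[OF
        derivable_trans[OF derivable_moments derivable_mixed_moments]
        derivable_gradient_features] derivable_outputs] A by simp
  then have "derivable {} (case_prod (activation d d_in k_max N R) ` ({..<N} \<times> {..<d_out}))
      (17 * (N * d_in * d_out * (k_max + d) + E * d_in * d))"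
    using A by (elim derivable_mono) (simp_all only: stage_costs_le order_refl)
  then show "inference_cost d d_in d_out k_max N R
      \<le> enat (17 * (N * d_in * d_out * (k_max + d) + E * d_in * d))"
    by (rule inference_cost_le) (simp add: activation_correct)
qed

end
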